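(* For every $n$-cell regular network, there exist special Jordan subspaces $J_1,\dots,J_m$ to the network such that $\mathbb{C}^n=J_1\oplus\cdots\oplus J_m$.
   Context: A regular network is a finite directed graph on cells $1,\dots,n$ (loops and multiple arrows allowed) in which every cell receives the same number $v$ of arrows (the valency). Its adjacency matrix $A=[a_{ij}]$ has $a_{ij}$ equal to the number of arrows cell $i$ receives from cell $j$; every row sum is $v$. $A$ acts on $\mathbb{C}^n$. A polydiagonal is a subspace of $\mathbb{C}^n$ of the form $\{x : x_i=x_j \text{ for all } (i,j)\in R\}$ for some (possibly empty) set $R$ of index pairs. $F=\{x_1=\cdots=x_n\}$ is the fully synchrony subspace. $P(W)$ is the smallest polydiagonal containing a subspace $W$. For an eigenvalue $\lambda$ of $A$, the generalized eigenspace is $G_\lambda=\operatorname{Ker}(A-\lambda I)^p$ for $p$ large. A Jordan chain of length $k$ for $\lambda$ is a sequence of nonzero vectors $x_1,\dots,x_k$ with $(A-\lambda I)x_1=0$ and $(A-\lambda I)x_i=x_{i-1}$ for $2\le i\le k$; a Jordan subspace is the span of a Jordan chain. A Jordan subspace $W$ of a generalized eigenspace $G$ is a special Jordan subspace to the network if for every Jordan subspace $U$ of $G$ with $\dim U=\dim W$ and $P(U)\subseteq P(W)$, either $P(U)=P(W)$ or $U=F$. *)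

theory Defs
  imports "HOL-Analysis.Analysis"
begin

text \<open>A regular network on the cells of the finite type 'n is given by its adjacency
  matrix A (A $ i $ j = number of arrows cell i receives from cell j), all row sums
  equal to the valency v.\<close>
definition regular_network :: "nat^'n^'n \<Rightarrow> nat \<Rightarrow> bool" where
  "regular_network A v \<longleftrightarrow> (\<forall>i. (\<Sum>j\<in>UNIV. A $ i $ j) = v)"

definition cmat :: "nat^'n^'n \<Rightarrow> complex^'n^'n" where
  "cmat A = (\<chi> i j. of_nat (A $ i $ j))"

definition polydiagonal :: "(complex^'n) set \<Rightarrow> bool" where
  "polydiagonal D \<longleftrightarrow> (\<exists>R :: ('n \<times> 'n) set. D = {x. \<forall>(i,j)\<in>R. x $ i = x $ j})"

definition poly_hull :: "(complex^'n) set \<Rightarrow> (complex^'n) set" where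
  "poly_hull W = \<Inter> {D. polydiagonal D \<and> W \<subseteq> D}"

definition full_sync :: "(complex^'n) set" where
  "full_sync = {x. \<forall>i j. x $ i = x $ j}"

definition shifted :: "complex^'n^'n \<Rightarrow> complex \<Rightarrow> complex^'n \<Rightarrow> complex^'n" where
  "shifted M l x = M *v x - l *s x"

definition eigenvalue :: "complex^'n^'n \<Rightarrow> complex \<Rightarrow> bool" where
  "eigenvalue M l \<longleftrightarrow> (\<exists>x. x \<noteq> 0 \<and> M *v x = l *s x)"

definition gen_eigenspace :: "complex^'n^'n \<Rightarrow> complex \<Rightarrow> (complex^'n) set" where
  "gen_eigenspace M l = {x. \<exists>p. (shifted M l ^^ p) x = 0}"

definition jordan_chain :: "complex^'n^'n \<Rightarrow> complex \<Rightarrow> nat \<Rightarrow> (nat \<Rightarrow> complex^'n) \<Rightarrow> bool" where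
  "jordan_chain M l k x \<longleftrightarrow> 1 \<le> k \<and> (\<forall>i\<in>{1..k}. x i \<noteq> 0) \<and>
     shifted M l (x 1) = 0 \<and> (\<forall>i\<in>{2..k}. shifted M l (x i) = x (i - 1))"

definition jordan_subspace :: "complex^'n^'n \<Rightarrow> complex \<Rightarrow> (complex^'n) set \<Rightarrow> bool" where
  "jordan_subspace M l W \<longleftrightarrow> eigenvalue M l \<and>
     (\<exists>k x. jordan_chain M l k x \<and> W = vec.span (x ` {1..k}))"

definition special_jordan_subspace :: "complex^'n^'n \<Rightarrow> complex \<Rightarrow> (complex^'n) set \<Rightarrow> bool" where
  "special_jordan_subspace M l W \<longleftrightarrow> jordan_subspace M l W \<and>
     (\<forall>U. jordan_subspace M l U \<and> vec.dim U = vec.dim W \<and> poly_hull U \<subseteq> poly_hull W \<longrightarrow>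
          poly_hull U = poly_hull W \<or> U = full_sync)"

definition direct_sum_whole :: "(complex^'n) set list \<Rightarrow> bool" where
  "direct_sum_whole Js \<longleftrightarrow> (\<forall>x :: complex^'n. \<exists>!ys. length ys = length Js \<and>
     (\<forall>i<length Js. ys ! i \<in> Js ! i) \<and> x = sum_list ys)"

end

theory Submission
  imports Defs "HOL-Computational_Algebra.Fundamental_Theorem_Algebra"
begin

text \<open>Among the finite families of Jordan chains spanning \<open>\<complex>\<^sup>n\<close>, take one whose total length is minimal and,
  subject to that, whose polydiagonal hulls are smallest. Minimal total length makes the sum direct,
  since a nontrivial relation lets one replace a chain by a shorter one. Suppose that a summand \<open>W\<close> with
  top vector \<open>w\<close> is not special, as witnessed by \<open>U\<close> with top vector \<open>u\<close>. If \<open>u\<close> has a nonzero component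
  along \<open>w\<close>, then \<open>U\<close> itself can replace \<open>W\<close>. Otherwise every \<open>w + p(N) u\<close> can, where \<open>N = A - \<lambda>I\<close>.
  If the eigenvector of \<open>U\<close> separates two cells, then \<open>p\<close> can be chosen (a triangular system) such that
  the new chain no longer separates them, so the hull gets strictly smaller. If it does not, then it is
  constant, and \<open>U = F\<close> because for a regular network no chain of length at least 2 starts with a
  constant vector.\<close>

section \<open>Shifted operators\<close>

lemma shifted_add: "shifted M l (x + y) = shifted M l x + shifted M l y"
  by (simp add: shifted_def matrix_vector_right_distrib vec.scale_right_distrib)

lemma shifted_scale: "shifted M l (c *s x) = c *s shifted M l x"
  by (simp add: shifted_def vector_scalar_commute vec.scale_right_diff_distrib mult.commute)

lemma linear_shifted: "Vector_Spaces.linear (*s) (*s) (shifted M l)"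
  by unfold_locales (simp_all add: shifted_add shifted_scale)

lemma linear_shifted_pow: "Vector_Spaces.linear (*s) (*s) (shifted M l ^^ i)"
proof (induction i)
  case 0
  show ?case by unfold_locales simp_all
next
  case (Suc i)
  show ?case
    using Vector_Spaces.linear_compose[OF Suc linear_shifted[of M l]] by (simp add: comp_def)
qed

lemmas shifted_pow_simps =
  vec.linear_add[OF linear_shifted_pow] vec.linear_scale[OF linear_shifted_pow]
  vec.linear_0[OF linear_shifted_pow] vec.linear_diff[OF linear_shifted_pow]

lemma shifted_0 [simp]: "shifted M l 0 = 0"
  by (simp add: vec.linear_0[OF linear_shifted])

lemma shifted_diff: "shifted M l (x - y) = shifted M l x - shifted M l y"
  by (simp add: vec.linear_diff[OF linear_shifted])

lemma shifted_commute: "shifted M l (shifted M m x) = shifted M m (shifted M l x)"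
  by (simp add: shifted_def matrix_vector_mult_diff_distrib vector_scalar_commute
      vec.scale_right_diff_distrib mult.commute algebra_simps)

lemma shifted_pow_commute: "(shifted M l ^^ i) (shifted M m x) = shifted M m ((shifted M l ^^ i) x)"
  by (induction i) (simp_all add: shifted_commute)

lemma shifted_pow_zero_mono:
  assumes "(shifted M l ^^ i) x = 0" "i \<le> j"
  shows "(shifted M l ^^ j) x = 0"
proof -
  have "(shifted M l ^^ j) x = (shifted M l ^^ (j - i)) ((shifted M l ^^ i) x)"
    using assms(2) by (simp flip: funpow_add[THEN fun_cong, unfolded comp_def])
  then show ?thesis
    using assms(1) by (simp add: shifted_pow_simps)
qed

section \<open>Subspaces invariant under the matrix\<close>

definition invariant_subspace :: "complex^'n^'n \<Rightarrow> (complex^'n) set \<Rightarrow> bool" where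
  "invariant_subspace M S \<longleftrightarrow> vec.subspace S \<and> (\<forall>x\<in>S. M *v x \<in> S)"

lemma invariant_subspace_shifted:
  "invariant_subspace M S \<Longrightarrow> x \<in> S \<Longrightarrow> shifted M l x \<in> S"
  by (simp add: invariant_subspace_def shifted_def vec.subspace_diff vec.subspace_scale)

lemma invariant_subspace_shifted_pow:
  "invariant_subspace M S \<Longrightarrow> x \<in> S \<Longrightarrow> (shifted M l ^^ i) x \<in> S"
  by (induction i) (auto intro: invariant_subspace_shifted)

lemma invariant_subspace_span:
  assumes "\<And>x. x \<in> B \<Longrightarrow> M *v x \<in> vec.span B"
  shows "invariant_subspace M (vec.span B)"
  unfolding invariant_subspace_def
proof (intro conjI ballI)
  fix x assume "x \<in> vec.span B"
  then show "M *v x \<in> vec.span B"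
  proof (induction rule: vec.span_induct_alt)
    case base
    show ?case by (simp add: vec.span_zero)
  next
    case (step c x y)
    then show ?case
      using assms by (simp add: matrix_vector_right_distrib vector_scalar_commute
          vec.span_add vec.span_scale)
  qed
qed simp

lemma invariant_subspace_span_Union:
  assumes "\<And>S. S \<in> \<C> \<Longrightarrow> invariant_subspace M S"
  shows "invariant_subspace M (vec.span (\<Union>\<C>))"
  using assms by (intro invariant_subspace_span) (auto simp: invariant_subspace_def intro: vec.span_base)

section \<open>Cyclic subspaces\<close>

text \<open>All iterates are taken, not only those up to a chain length, so that invariance holds
  for arbitrary \<open>w\<close>.\<close>

definition cyc :: "complex^'n^'n \<Rightarrow> complex \<Rightarrow> complex^'n \<Rightarrow> (complex^'n) set" where
  "cyc M l w = vec.span (range (\<lambda>i. (shifted M l ^^ i) w))"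

text \<open>For a generalized eigenvector \<open>w\<close> this is the length of the Jordan chain
  with top vector \<open>w\<close>, and 0 if \<open>w = 0\<close>. For other vectors
  \<open>LEAST\<close> gives an unspecified value.\<close>

definition nil_len :: "complex^'n^'n \<Rightarrow> complex \<Rightarrow> complex^'n \<Rightarrow> nat" where
  "nil_len M l w = (LEAST k. (shifted M l ^^ k) w = 0)"

lemma cyc_pow_mem: "(shifted M l ^^ i) w \<in> cyc M l w"
  by (auto simp: cyc_def intro: vec.span_base)

lemma cyc_self: "w \<in> cyc M l w"
  using cyc_pow_mem[of 0 M l] by simp

lemma subspace_cyc [simp]: "vec.subspace (cyc M l w)"
  by (simp add: cyc_def)

lemma invariant_subspace_cyc: "invariant_subspace M (cyc M l w)"
  unfolding cyc_def
proof (rule invariant_subspace_span, clarify)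
  fix i
  have "M *v (shifted M l ^^ i) w = (shifted M l ^^ Suc i) w + l *s (shifted M l ^^ i) w"
    by (simp add: shifted_def)
  also have "\<dots> \<in> cyc M l w"
    by (intro vec.subspace_add vec.subspace_scale subspace_cyc cyc_pow_mem)
  finally show "M *v (shifted M l ^^ i) w \<in> vec.span (range (\<lambda>i. (shifted M l ^^ i) w))"
    by (simp add: cyc_def)
qed

lemma cyc_minimal: "invariant_subspace M S \<Longrightarrow> w \<in> S \<Longrightarrow> cyc M l w \<subseteq> S"
  unfolding cyc_def
  by (intro vec.span_minimal) (auto intro: invariant_subspace_shifted_pow simp: invariant_subspace_def)

lemma cyc_0 [simp]: "cyc M l 0 = {0}"
  by (auto simp: cyc_def shifted_pow_simps vec.span_insert_0 image_constant_conv)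

text \<open>Every iterate of \<open>w\<close> except the zeroth is an iterate of
  \<open>shifted M l w\<close>. Whether \<open>a\<close> vanishes later decides if a vector can
  replace \<open>w\<close> as a generator.\<close>

lemma cyc_decompose:
  assumes "z \<in> cyc M l w"
  obtains a r where "z = a *s w + r" "r \<in> cyc M l (shifted M l w)"
proof -
  have "range (\<lambda>i. (shifted M l ^^ i) w) \<subseteq> insert w (cyc M l (shifted M l w))"
  proof clarify
    fix i assume *: "(shifted M l ^^ i) w \<notin> cyc M l (shifted M l w)"
    show "(shifted M l ^^ i) w = w"
    proof (cases i)
      case (Suc j)
      then show ?thesis
        using * cyc_pow_mem[of j M l "shifted M l w"] by (simp add: shifted_pow_commute)
    qed simp
  qed
  then have "z \<in> vec.span (insert w (cyc M l (shifted M l w)))"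
    using assms vec.span_mono unfolding cyc_def by blast
  then obtain a where "z - a *s w \<in> vec.span (cyc M l (shifted M l w))"
    unfolding vec.span_breakdown_eq by blast
  then have "z - a *s w \<in> cyc M l (shifted M l w)"
    by (simp add: vec.span_eq_iff[THEN iffD2])
  then show thesis
    by (intro that[of a "z - a *s w"]) simp_all
qed

lemma cyc_shifted_subset: "cyc M l ((shifted M l ^^ i) w) \<subseteq> cyc M l w"
  by (intro cyc_minimal invariant_subspace_cyc cyc_pow_mem)

lemma shifted_pow_cyc:
  assumes "z \<in> cyc M l w"
  shows "(shifted M l ^^ i) z \<in> cyc M l ((shifted M l ^^ i) w)"
  using assms unfolding cyc_def
proof (induction rule: vec.span_induct_alt)
  case base
  show ?case by (simp add: shifted_pow_simps vec.span_zero)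
next
  case (step c x y)
  then obtain j where x: "x = (shifted M l ^^ j) w" by blast
  have "(shifted M l ^^ i) x = (shifted M l ^^ j) ((shifted M l ^^ i) w)"
    unfolding x by (metis add.commute comp_apply funpow_add)
  then have "(shifted M l ^^ i) x \<in> vec.span (range (\<lambda>ia. (shifted M l ^^ ia) ((shifted M l ^^ i) w)))"
    by (auto intro: vec.span_base)
  with step show ?case
    by (simp add: shifted_pow_simps vec.span_add vec.span_scale)
qed

lemma cyc_pow_zero:
  assumes "(shifted M l ^^ k) w = 0" "z \<in> cyc M l w"
  shows "(shifted M l ^^ k) z = 0"
  using shifted_pow_cyc[OF assms(2), of k] assms(1) by simp

section \<open>Generalized eigenvectors and chain lengths\<close>

lemma gen_eigenspace_shifted:
  "w \<in> gen_eigenspace M l \<Longrightarrow> shifted M m w \<in> gen_eigenspace M l"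
  by (auto simp: gen_eigenspace_def shifted_pow_commute) (metis shifted_0)

lemma cyc_subset_gen_eigenspace: "w \<in> gen_eigenspace M l \<Longrightarrow> cyc M l w \<subseteq> gen_eigenspace M l"
  unfolding gen_eigenspace_def using cyc_pow_zero by blast

lemma nil_len_zero: "w \<in> gen_eigenspace M l \<Longrightarrow> (shifted M l ^^ nil_len M l w) w = 0"
  unfolding gen_eigenspace_def nil_len_def mem_Collect_eq by (rule LeastI_ex)

lemma nil_len_le: "(shifted M l ^^ k) w = 0 \<Longrightarrow> nil_len M l w \<le> k"
  unfolding nil_len_def by (rule Least_le)

lemma nil_len_le_iff:
  "w \<in> gen_eigenspace M l \<Longrightarrow> (shifted M l ^^ k) w = 0 \<longleftrightarrow> nil_len M l w \<le> k"
  using nil_len_le nil_len_zero shifted_pow_zero_mono by metis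

lemma nil_len_0 [simp]: "nil_len M l 0 = 0"
  using nil_len_le[of 0 M l 0] by simp

lemma nil_len_pos: "w \<in> gen_eigenspace M l \<Longrightarrow> w \<noteq> 0 \<Longrightarrow> 0 < nil_len M l w"
  using nil_len_le_iff[of w M l 0] by simp

lemma nil_len_shifted:
  assumes "w \<in> gen_eigenspace M l"
  shows "nil_len M l (shifted M l w) = nil_len M l w - 1"
proof -
  have "nil_len M l (shifted M l w) \<le> k \<longleftrightarrow> nil_len M l w \<le> Suc k" for k
    using nil_len_le_iff[OF assms, of "Suc k"]
      nil_len_le_iff[OF gen_eigenspace_shifted[OF assms, of l], of k]
    by (simp add: shifted_pow_commute)
  then have "nil_len M l (shifted M l w) \<le> k \<longleftrightarrow> nil_len M l w - 1 \<le> k" for k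
    by (simp add: le_diff_conv)
  then show ?thesis
    using le_antisym le_refl by metis
qed

lemma cyc_eq_span_image:
  assumes "(shifted M l ^^ k) w = 0"
  shows "cyc M l w = vec.span ((\<lambda>i. (shifted M l ^^ i) w) ` {..<k})"
proof -
  have "range (\<lambda>i. (shifted M l ^^ i) w) \<subseteq> insert 0 ((\<lambda>i. (shifted M l ^^ i) w) ` {..<k})"
  proof clarify
    fix i assume *: "(shifted M l ^^ i) w \<notin> (\<lambda>i. (shifted M l ^^ i) w) ` {..<k}"
    then have "k \<le> i" by (meson image_eqI lessThan_iff not_le)
    then show "(shifted M l ^^ i) w = 0" by (rule shifted_pow_zero_mono[OF assms])
  qed
  then have "cyc M l w \<subseteq> vec.span ((\<lambda>i. (shifted M l ^^ i) w) ` {..<k})"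
    unfolding cyc_def using vec.span_mono vec.span_insert_0 by metis
  moreover have "vec.span ((\<lambda>i. (shifted M l ^^ i) w) ` {..<k}) \<subseteq> cyc M l w"
    unfolding cyc_def by (intro vec.span_mono) auto
  ultimately show ?thesis by simp
qed

text \<open>Each step up the chain adds one dimension: the power that annihilates the cyclic
  subspace of \<open>shifted M l w\<close> does not annihilate \<open>w\<close>.\<close>

lemma dim_cyc:
  assumes "w \<in> gen_eigenspace M l"
  shows "vec.dim (cyc M l w) = nil_len M l w"
  using assms
proof (induction "nil_len M l w" arbitrary: w)
  case 0
  then have "w = 0" using nil_len_pos by fastforce
  then show ?case by (simp add: vec.dim_eq_0)
next
  case (Suc k)
  let ?w = "shifted M l w"
  have k: "nil_len M l ?w = k"
    using nil_len_shifted[OF Suc.prems] Suc.hyps(2) by simp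
  have w': "?w \<in> gen_eigenspace M l" by (rule gen_eigenspace_shifted[OF Suc.prems])
  have "cyc M l w = vec.span (insert w (cyc M l ?w))"
  proof
    show "cyc M l w \<subseteq> vec.span (insert w (cyc M l ?w))"
      by (rule subsetI, erule cyc_decompose)
        (auto intro: vec.span_add vec.span_scale vec.span_base)
    show "vec.span (insert w (cyc M l ?w)) \<subseteq> cyc M l w"
      using cyc_shifted_subset[of M l 1 w] by (intro vec.span_minimal) (auto simp: cyc_self)
  qed
  moreover have "w \<notin> cyc M l ?w"
    using cyc_pow_zero[of k M l ?w w] nil_len_zero[OF w'] nil_len_le[of k M l w] k Suc.hyps(2)
    by auto
  ultimately show ?case
    using Suc.hyps(1)[OF k[symmetric] w'] k Suc.hyps(2)
    by (simp add: vec.dim_insert vec.span_eq_iff[THEN iffD2])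
qed

text \<open>The kernel inside a cyclic subspace is the line through the bottom vector of the chain.
  For \<open>k > 0\<close> the \<open>k\<close>-th power kills \<open>z\<close> and \<open>r\<close>
  in \<open>z = a *s w + r\<close>, but not \<open>w\<close>; so \<open>a = 0\<close> and the
  shorter chain takes over.\<close>

lemma cyc_socle:
  assumes "w \<in> gen_eigenspace M l" "z \<in> cyc M l w" "shifted M l z = 0"
  shows "\<exists>c. z = c *s (shifted M l ^^ (nil_len M l w - 1)) w"
  using assms
proof (induction "nil_len M l w" arbitrary: w)
  case 0
  then have "w = 0" using nil_len_pos by fastforce
  with 0 show ?case by simp
next
  case (Suc k)
  let ?w = "shifted M l w"
  have k: "nil_len M l ?w = k"
    using nil_len_shifted[OF Suc.prems(1)] Suc.hyps(2) by simp
  have w': "?w \<in> gen_eigenspace M l" by (rule gen_eigenspace_shifted[OF Suc.prems(1)])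
  obtain a r where z: "z = a *s w + r" "r \<in> cyc M l ?w"
    using Suc.prems(2) by (rule cyc_decompose)
  have rk: "(shifted M l ^^ k) r = 0"
    using cyc_pow_zero[OF nil_len_zero[OF w'] z(2)] k by simp
  show ?case
  proof (cases "k = 0")
    \<comment> \<open>Here \<open>w\<close> is itself an eigenvector and \<open>rk\<close> reads
      \<open>r = 0\<close>.\<close>
    case True
    then show ?thesis using z rk Suc.hyps(2) by auto
  next
    case False
    then have "(shifted M l ^^ k) z = 0"
      using shifted_pow_zero_mono[of 1 M l z k] Suc.prems(3) by simp
    then have "a *s (shifted M l ^^ k) w = 0"
      using z(1) rk by (simp add: shifted_pow_simps)
    moreover have "(shifted M l ^^ k) w \<noteq> 0"
      using nil_len_le[of k M l w] Suc.hyps(2) by auto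
    ultimately have "z \<in> cyc M l ?w" using z by simp
    then obtain c where "z = c *s (shifted M l ^^ (k - 1)) ?w"
      using Suc.hyps(1)[OF k[symmetric] w' _ Suc.prems(3)] k by auto
    also have "(shifted M l ^^ (k - 1)) ?w = (shifted M l ^^ k) w"
      using False by (cases k) (simp_all add: shifted_pow_commute)
    finally show ?thesis using Suc.hyps(2) by (metis diff_Suc_1)
  qed
qed

section \<open>Jordan subspaces as cyclic subspaces\<close>

lemma image_diff_lessThan: "(\<lambda>i. k - i) ` {..<k} = {1..k::nat}"
proof
  show "{1..k} \<subseteq> (\<lambda>i. k - i) ` {..<k}"
  proof
    fix x assume "x \<in> {1..k}"
    then show "x \<in> (\<lambda>i. k - i) ` {..<k}"
      by (intro image_eqI[of _ _ "k - x"]) auto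
  qed
qed auto

lemma image_diff_atLeastAtMost: "(\<lambda>i. k - i) ` {1..k} = {..<k::nat}"
proof
  show "{..<k} \<subseteq> (\<lambda>i. k - i) ` {1..k}"
  proof
    fix x assume "x \<in> {..<k}"
    then show "x \<in> (\<lambda>i. k - i) ` {1..k}"
      by (intro image_eqI[of _ _ "k - x"]) auto
  qed
qed auto

text \<open>Chains are numbered upwards from the eigenvector, iterates downwards from the top
  vector, hence the index reversal \<open>k - i\<close>.\<close>

lemma jordan_subspace_iff_cyc:
  "jordan_subspace M l W \<longleftrightarrow> (\<exists>w. w \<noteq> 0 \<and> w \<in> gen_eigenspace M l \<and> W = cyc M l w)"
proof
  assume "jordan_subspace M l W"
  then obtain k x where ch: "jordan_chain M l k x" and W: "W = vec.span (x ` {1..k})"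
    unfolding jordan_subspace_def by blast
  have k: "1 \<le> k" and x0: "x k \<noteq> 0" using ch by (auto simp: jordan_chain_def)
  have pow: "(shifted M l ^^ i) (x k) = x (k - i)" if "i < k" for i
    using that
  proof (induction i)
    case (Suc i)
    then have "shifted M l (x (k - i)) = x (k - i - 1)"
      using ch by (auto simp: jordan_chain_def)
    with Suc show ?case by simp
  qed simp
  have "(shifted M l ^^ k) (x k) = shifted M l ((shifted M l ^^ (k - 1)) (x k))"
    using k by (cases k) auto
  then have zero: "(shifted M l ^^ k) (x k) = 0"
    using pow[of "k - 1"] k ch by (simp add: jordan_chain_def)
  have "(\<lambda>i. (shifted M l ^^ i) (x k)) ` {..<k} = (\<lambda>i. x (k - i)) ` {..<k}"
    using pow by (intro image_cong) auto
  also have "\<dots> = x ` ((\<lambda>i. k - i) ` {..<k})" by (simp add: image_image)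
  also have "(\<lambda>i. k - i) ` {..<k} = {1..k}"
    by (rule image_diff_lessThan)
  finally have "W = cyc M l (x k)"
    using W cyc_eq_span_image[OF zero] by simp
  then show "\<exists>w. w \<noteq> 0 \<and> w \<in> gen_eigenspace M l \<and> W = cyc M l w"
    using x0 zero by (auto simp: gen_eigenspace_def)
next
  assume "\<exists>w. w \<noteq> 0 \<and> w \<in> gen_eigenspace M l \<and> W = cyc M l w"
  then obtain w where w: "w \<noteq> 0" "w \<in> gen_eigenspace M l" and W: "W = cyc M l w" by blast
  define k where "k = nil_len M l w"
  define x where "x i = (shifted M l ^^ (k - i)) w" for i
  have k: "1 \<le> k" using nil_len_pos[OF w(2,1)] by (simp add: k_def)
  have nz: "x i \<noteq> 0" if "i \<in> {1..k}" for i
    using nil_len_le[of "k - i" M l w] that by (auto simp: x_def k_def)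
  have down: "shifted M l (x i) = (shifted M l ^^ (Suc k - i)) w" if "i \<le> k" for i
    using that by (simp add: x_def Suc_diff_le)
  have x1: "shifted M l (x 1) = 0"
    using down[of 1] k nil_len_zero[OF w(2)] by (simp add: k_def)
  have "jordan_chain M l k x"
    unfolding jordan_chain_def using k nz x1 down by (auto simp: x_def)
  moreover have "x ` {1..k} = (\<lambda>i. (shifted M l ^^ i) w) ` ((\<lambda>i. k - i) ` {1..k})"
    by (simp add: image_image x_def)
  moreover have "(\<lambda>i. k - i) ` {1..k} = {..<k}"
    by (rule image_diff_atLeastAtMost)
  moreover have "eigenvalue M l"
    unfolding eigenvalue_def using nz[of 1] x1 k by (intro exI[of _ "x 1"]) (auto simp: shifted_def)
  ultimately show "jordan_subspace M l W"
    unfolding jordan_subspace_def W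
    using cyc_eq_span_image[OF nil_len_zero[OF w(2)]] k_def by metis
qed

section \<open>Generalized eigenvectors span\<close>

text \<open>Horner evaluation of \<open>p\<close> at the matrix \<open>M\<close>, applied to
  \<open>x\<close>.\<close>

definition poly_apply :: "complex^'n^'n \<Rightarrow> complex poly \<Rightarrow> complex^'n \<Rightarrow> complex^'n" where
  "poly_apply M p x = fold_coeffs (\<lambda>a y. a *s x + M *v y) p 0"

lemma poly_apply_0 [simp]: "poly_apply M 0 x = 0"
  by (simp add: poly_apply_def)

lemma poly_apply_pCons [simp]: "poly_apply M (pCons a p) x = a *s x + M *v poly_apply M p x"
  by (cases "p = 0 \<and> a = 0") (auto simp: poly_apply_def)

lemma poly_apply_add: "poly_apply M (p + q) x = poly_apply M p x + poly_apply M q x"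
  by (induction p q rule: poly_induct2)
    (simp_all add: matrix_vector_right_distrib vec.scale_left_distrib algebra_simps)

lemma poly_apply_smult: "poly_apply M (smult c p) x = c *s poly_apply M p x"
  by (induction p) (simp_all add: vector_scalar_commute vec.scale_right_distrib)

lemma poly_apply_sum: "finite I \<Longrightarrow> poly_apply M (\<Sum>i\<in>I. p i) x = (\<Sum>i\<in>I. poly_apply M (p i) x)"
  by (induction I rule: finite_induct) (simp_all add: poly_apply_add)

lemma poly_apply_monom: "poly_apply M (monom c i) x = c *s ((\<lambda>y. M *v y) ^^ i) x"
  by (induction i) (simp_all add: monom_Suc monom_0 vector_scalar_commute)

lemma poly_apply_shifted: "poly_apply M p (shifted M l x) = shifted M l (poly_apply M p x)"
  \<comment> \<open>\<open>shifted M 0\<close> is multiplication by \<open>M\<close>, so the case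
    \<open>m = 0\<close> of \<open>shifted_commute\<close> moves \<open>M\<close> past
    \<open>shifted M l\<close>.\<close>
  by (induction p)
    (simp_all add: shifted_add shifted_scale shifted_commute[of M _ 0, unfolded shifted_def[of M 0], simplified])

text \<open>A root splits off a linear factor, which acts as \<open>shifted M z\<close>.\<close>

lemma poly_apply_root:
  assumes "poly p z = 0"
  shows "poly_apply M p x = poly_apply M (synthetic_div p z) (shifted M z x)"
proof -
  have "poly_apply M (p + smult z (synthetic_div p z)) x = poly_apply M (pCons 0 (synthetic_div p z)) x"
    using synthetic_div_correct[of p z] assms by simp
  then show ?thesis
    unfolding poly_apply_shifted
    by (simp add: poly_apply_add poly_apply_smult shifted_def algebra_simps)
qed

text \<open>The \<open>CARD('n) + 1\<close> vectors \<open>x\<close>, \<open>M x\<close>,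
  \<open>M (M x)\<close> and so on are too many to be independent; a linear relation among them is
  read as a polynomial.\<close>

lemma exists_annihilating_poly:
  fixes M :: "complex^'n^'n"
  shows "\<exists>p. p \<noteq> 0 \<and> poly_apply M p x = 0"
proof -
  define f where "f i = ((\<lambda>y. M *v y) ^^ i) x" for i
  let ?I = "{..CARD('n)}"
  show ?thesis
  proof (cases "inj_on f ?I")
    \<comment> \<open>Dependence is a property of sets, so a coincidence among these vectors is
      treated apart; it gives a difference of two monomials.\<close>
    case False
    then obtain i j where ij: "i \<noteq> j" "f i = f j" by (auto simp: inj_on_def)
    have "poly_apply M (monom 1 i + monom (-1) j) x = 0"
      using ij by (simp add: poly_apply_add poly_apply_monom f_def)
    moreover have "coeff (monom 1 i + monom (-1) j) i = (1::complex)"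
      using ij by simp
    then have "monom 1 i + monom (-1) j \<noteq> (0 :: complex poly)" by force
    ultimately show ?thesis by blast
  next
    case True
    then have "card (f ` ?I) = CARD('n) + 1" by (simp add: card_image)
    then have "vec.dependent (f ` ?I)"
      using vec.independent_card_le_dim[of "f ` ?I" UNIV] vec.dim_UNIV
      by (metis add.commute card_cart_basis not_add_less1 not_less_eq_eq plus_1_eq_Suc subset_UNIV
          le_refl vec.dimension_def)
    then obtain u where u: "\<exists>v\<in>f ` ?I. u v \<noteq> 0" "(\<Sum>v\<in>f ` ?I. u v *s v) = 0"
      using vec.dependent_finite[of "f ` ?I"] by auto
    define p where "p = (\<Sum>i\<in>?I. monom (u (f i)) i)"
    have "poly_apply M p x = (\<Sum>i\<in>?I. u (f i) *s f i)"
      by (simp add: p_def poly_apply_sum poly_apply_monom f_def)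
    also have "\<dots> = 0" using u(2) by (simp add: sum.reindex[OF True])
    finally have "poly_apply M p x = 0" .
    moreover obtain i where i: "i \<in> ?I" "u (f i) \<noteq> 0" using u(1) by auto
    have "coeff p i = u (f i)"
      using i(1) by (simp add: p_def coeff_sum sum.delta)
    then have "p \<noteq> 0" using i(2) by auto
    ultimately show ?thesis by blast
  qed
qed

lemma subspace_gen_eigenspace: "vec.subspace (gen_eigenspace M l)"
proof (rule vec.subspaceI)
  show "0 \<in> gen_eigenspace M l" by (auto simp: gen_eigenspace_def shifted_pow_simps)
next
  fix x y assume "x \<in> gen_eigenspace M l" "y \<in> gen_eigenspace M l"
  then obtain i j where "(shifted M l ^^ i) x = 0" "(shifted M l ^^ j) y = 0"
    by (auto simp: gen_eigenspace_def)
  then have "(shifted M l ^^ max i j) x = 0" "(shifted M l ^^ max i j) y = 0"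
    by (auto intro: shifted_pow_zero_mono)
  then show "x + y \<in> gen_eigenspace M l"
    by (auto simp: gen_eigenspace_def shifted_pow_simps intro!: exI[of _ "max i j"])
next
  fix c x assume "x \<in> gen_eigenspace M l"
  then show "c *s x \<in> gen_eigenspace M l"
    by (auto simp: gen_eigenspace_def shifted_pow_simps)
qed

text \<open>On the generalized eigenspaces for \<open>l' \<noteq> l\<close> the operator \<open>shifted M l\<close> is onto, so the sum of all
  generalized eigenspaces is closed under preimages of \<open>shifted M l\<close>.\<close>

lemma span_gen_eigenspaces_preimage:
  assumes "shifted M l x \<in> vec.span (\<Union>m. gen_eigenspace M m)"
  shows "x \<in> vec.span (\<Union>m. gen_eigenspace M m)"
proof -
  let ?S = "vec.span (\<Union>m. gen_eigenspace M m)"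
  \<comment> \<open>One generalized eigenvector at a time; linearity then extends the decomposition
    to the whole span.\<close>
  have decomp: "\<exists>y z. y \<in> gen_eigenspace M l \<and> z \<in> ?S \<and> w = y + shifted M l z"
    if w: "(shifted M m ^^ k) w = 0" for w m k
    using w
  proof (induction k arbitrary: w)
    case 0
    then show ?case
      by (intro exI[of _ 0]) (auto simp: vec.span_zero vec.subspace_0 subspace_gen_eigenspace)
  next
    case (Suc k)
    have wm: "w \<in> gen_eigenspace M m" using Suc.prems unfolding gen_eigenspace_def by blast
    show ?case
    proof (cases "m = l")
      case True
      then show ?thesis
        using wm by (intro exI[of _ w] exI[of _ 0]) (auto simp: vec.span_zero)
    next
      case False
      have "(shifted M m ^^ k) (shifted M m w) = 0"
        using Suc.prems by (simp add: shifted_pow_commute)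
      then obtain y z where yz: "y \<in> gen_eigenspace M l" "z \<in> ?S" "shifted M m w = y + shifted M l z"
        using Suc.IH by blast
      \<comment> \<open>\<open>shifted M l\<close> and \<open>shifted M m\<close> differ by the
        nonzero scalar \<open>m - l\<close>, so dividing by it recovers \<open>w\<close>.\<close>
      let ?c = "1 / (m - l)"
      have "shifted M l w - shifted M m w = (m - l) *s w"
        by (simp add: shifted_def vec.scale_left_diff_distrib)
      then have "?c *s (shifted M l w - shifted M m w) = (?c * (m - l)) *s w"
        by (simp only: vec.scale_scale)
      then have "w = ?c *s (shifted M l w - shifted M m w)"
        using False by simp
      also have "\<dots> = (- ?c) *s y + shifted M l (?c *s (w - z))"
        unfolding yz(3) shifted_scale shifted_diff vec.scale_right_diff_distrib
            vec.scale_right_distrib vec.scale_minus_left by simp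
      finally have "w = (- ?c) *s y + shifted M l (?c *s (w - z))" .
      moreover have "(- ?c) *s y \<in> gen_eigenspace M l"
        by (rule vec.subspace_scale[OF subspace_gen_eigenspace yz(1)])
      moreover have "?c *s (w - z) \<in> ?S"
        using wm yz(2) by (intro vec.span_scale vec.span_diff) (auto intro: vec.span_base)
      ultimately show ?thesis by blast
    qed
  qed
  have "\<exists>y z. y \<in> gen_eigenspace M l \<and> z \<in> ?S \<and> shifted M l x = y + shifted M l z"
    using assms
  proof (induction rule: vec.span_induct_alt)
    case base
    show ?case
      by (intro exI[of _ 0]) (auto simp: vec.span_zero vec.subspace_0 subspace_gen_eigenspace)
  next
    case (step c a b)
    from step(1) obtain y z where 1: "y \<in> gen_eigenspace M l" "z \<in> ?S" "a = y + shifted M l z"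
      using decomp unfolding gen_eigenspace_def by blast
    from step(2) obtain y' z' where 2: "y' \<in> gen_eigenspace M l" "z' \<in> ?S" "b = y' + shifted M l z'"
      by blast
    have "c *s a + b = (c *s y + y') + shifted M l (c *s z + z')"
      using 1 2 by (simp add: shifted_add shifted_scale vec.scale_right_distrib algebra_simps)
    moreover have "c *s y + y' \<in> gen_eigenspace M l"
      using 1 2 by (intro vec.subspace_add vec.subspace_scale subspace_gen_eigenspace)
    moreover have "c *s z + z' \<in> ?S"
      using 1 2 by (intro vec.span_add vec.span_scale)
    ultimately show ?case by blast
  qed
  then obtain y z where yz: "y \<in> gen_eigenspace M l" "z \<in> ?S" "shifted M l x = y + shifted M l z"
    by blast
  \<comment> \<open>As \<open>x - z\<close> is sent to a generalized eigenvector for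
    \<open>l\<close>, one more power annihilates it.\<close>
  then have "shifted M l (x - z) \<in> gen_eigenspace M l" by (simp add: shifted_diff)
  then obtain p where "(shifted M l ^^ p) (shifted M l (x - z)) = 0"
    by (auto simp: gen_eigenspace_def)
  then have "(shifted M l ^^ Suc p) (x - z) = 0"
    by (simp add: shifted_pow_commute)
  then have "x - z \<in> gen_eigenspace M l" unfolding gen_eigenspace_def by blast
  then have "(x - z) + z \<in> ?S"
    using yz(2) by (intro vec.span_add) (auto intro: vec.span_base)
  then show ?thesis by simp
qed

text \<open>Induction on the degree of a polynomial annihilating \<open>x\<close>: a root
  \<open>z\<close> gives one of smaller degree annihilating \<open>shifted M z x\<close>, and
  closure under preimages leads back to \<open>x\<close>.\<close>

lemma span_gen_eigenspaces:
  fixes M :: "complex^'n^'n"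
  shows "vec.span (\<Union>l. gen_eigenspace M l) = UNIV"
proof -
  let ?S = "vec.span (\<Union>l. gen_eigenspace M l)"
  have "x \<in> ?S" if "p \<noteq> 0" "poly_apply M p x = 0" for p x
    using that
  proof (induction "degree p" arbitrary: p x)
    case 0
    then obtain c where "p = [:c:]" "c \<noteq> 0"
      by (metis degree_eq_zeroE pCons_0_0)
    with 0 have "x = 0" by simp
    then show ?case by (simp add: vec.span_zero)
  next
    case (Suc d)
    then have "\<not> constant (poly p)" by (simp add: constant_degree)
    then obtain z where z: "poly p z = 0"
      using fundamental_theorem_of_algebra by blast
    have "d = degree (synthetic_div p z)"
      using Suc.hyps(2) by (simp add: degree_synthetic_div)
    moreover have "synthetic_div p z \<noteq> 0"
      using Suc.hyps(2) synthetic_div_eq_0_iff[of p z] by auto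
    ultimately have "shifted M z x \<in> ?S"
      using Suc.hyps(1) Suc.prems(2) poly_apply_root[OF z] by metis
    then show ?case by (rule span_gen_eigenspaces_preimage)
  qed
  then show ?thesis using exists_annihilating_poly[of M] by blast
qed

section \<open>Separated pairs of cells\<close>

text \<open>The complement consists of the equations that cut out the polydiagonal hull. Being
  finite, the set turns the size of the hull into a number.\<close>

definition separated :: "(complex^'n) set \<Rightarrow> ('n \<times> 'n) set" where
  "separated W = {(a, b). \<exists>z\<in>W. z $ a \<noteq> z $ b}"

lemma separated_mono: "U \<subseteq> W \<Longrightarrow> separated U \<subseteq> separated W"
  by (auto simp: separated_def)

text \<open>The right-hand side is itself a polydiagonal containing \<open>W\<close>, and every pair
  in the relation of a polydiagonal containing \<open>W\<close> is unseparated.\<close>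

lemma poly_hull_eq: "poly_hull W = {x. \<forall>a b. (a, b) \<notin> separated W \<longrightarrow> x $ a = x $ b}" (is "_ = ?D")
proof
  have "?D = {x. \<forall>(a, b)\<in>- separated W. x $ a = x $ b}" by auto
  then have "polydiagonal ?D" unfolding polydiagonal_def by blast
  then show "poly_hull W \<subseteq> ?D"
    unfolding poly_hull_def by (intro Inter_lower) (auto simp: separated_def)
  show "?D \<subseteq> poly_hull W"
    unfolding poly_hull_def
  proof (intro Inter_greatest subsetI)
    fix D x assume "D \<in> {D. polydiagonal D \<and> W \<subseteq> D}" and x: "x \<in> ?D"
    then obtain R where D: "D = {x. \<forall>(a, b)\<in>R. x $ a = x $ b}" and "W \<subseteq> D"
      by (auto simp: polydiagonal_def)
    then have "(a, b) \<notin> separated W" if "(a, b) \<in> R" for a b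
      using that by (auto simp: separated_def)
    then show "x \<in> D" using x by (auto simp: D)
  qed
qed

lemma separated_poly_hull: "separated (poly_hull W) = separated W"
  unfolding poly_hull_eq by (auto simp: separated_def)

lemma separated_mono_poly_hull: "poly_hull U \<subseteq> poly_hull W \<Longrightarrow> separated U \<subseteq> separated W"
  using separated_mono[of "poly_hull U" "poly_hull W"] by (simp add: separated_poly_hull)

text \<open>Equality of two coordinates is a linear condition, so testing the spanning vectors
  suffices.\<close>

lemma separated_cyc:
  "(a, b) \<in> separated (cyc M l w) \<longleftrightarrow> (\<exists>i. ((shifted M l ^^ i) w) $ a \<noteq> ((shifted M l ^^ i) w) $ b)"
proof
  assume "\<exists>i. ((shifted M l ^^ i) w) $ a \<noteq> ((shifted M l ^^ i) w) $ b"
  then show "(a, b) \<in> separated (cyc M l w)"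
    using cyc_pow_mem unfolding separated_def by blast
next
  assume sep: "(a, b) \<in> separated (cyc M l w)"
  show "\<exists>i. ((shifted M l ^^ i) w) $ a \<noteq> ((shifted M l ^^ i) w) $ b"
  proof (rule ccontr)
    assume "\<nexists>i. ((shifted M l ^^ i) w) $ a \<noteq> ((shifted M l ^^ i) w) $ b"
    then have "cyc M l w \<subseteq> {z. z $ a = z $ b}"
      unfolding cyc_def by (intro vec.span_minimal) (auto intro: vec.subspaceI)
    then show False using sep by (auto simp: separated_def)
  qed
qed

section \<open>Spanning families of cyclic subspaces of minimal weight\<close>

text \<open>A member of \<open>G\<close> pairs an eigenvalue with the top vector of a chain.\<close>

definition cyc_span :: "complex^'n^'n \<Rightarrow> (complex \<times> (complex^'n)) set \<Rightarrow> (complex^'n) set" where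
  "cyc_span M G = vec.span (\<Union>g\<in>G. cyc M (fst g) (snd g))"

text \<open>Directness is left to follow from minimal weight, so that an exchange of generators only
  has to preserve spanning.\<close>

definition spanning_family :: "complex^'n^'n \<Rightarrow> (complex \<times> (complex^'n)) set \<Rightarrow> bool" where
  "spanning_family M G \<longleftrightarrow> finite G \<and> cyc_span M G = UNIV \<and>
     (\<forall>g\<in>G. snd g \<noteq> 0 \<and> snd g \<in> gen_eigenspace M (fst g))"

text \<open>The factor makes the weight lexicographic: first the dimension, then the number of separated
  pairs of cells, which measures the size of the polydiagonal hull.\<close>

definition cyc_weight :: "complex^'n^'n \<Rightarrow> complex \<times> (complex^'n) \<Rightarrow> nat" where
  "cyc_weight M g = nil_len M (fst g) (snd g) * (CARD('n \<times> 'n) + 1)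
     + card (separated (cyc M (fst g) (snd g)))"

definition minimal_family :: "complex^'n^'n \<Rightarrow> (complex \<times> (complex^'n)) set \<Rightarrow> bool" where
  "minimal_family M G \<longleftrightarrow> spanning_family M G \<and>
     (\<forall>G'. spanning_family M G' \<longrightarrow> sum (cyc_weight M) G \<le> sum (cyc_weight M) G')"

text \<open>The number of separated pairs stays below the factor, so it cannot make up for a
  difference in length.\<close>

lemma cyc_weight_less_len:
  fixes M :: "complex^'n^'n"
  assumes "nil_len M l y < nil_len M l w"
  shows "cyc_weight M (l, y) < cyc_weight M (l, w)"
proof -
  let ?C = "CARD('n \<times> 'n) + 1"
  have "card (separated (cyc M l y)) < ?C"
    using card_mono[OF finite subset_UNIV, of "separated (cyc M l y)"] by linarith
  then have "cyc_weight M (l, y) < Suc (nil_len M l y) * ?C"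
    by (simp add: cyc_weight_def)
  also have "\<dots> \<le> nil_len M l w * ?C"
    using assms by (intro mult_right_mono) auto
  finally show ?thesis by (simp add: cyc_weight_def)
qed

lemma cyc_weight_less_separated:
  fixes M :: "complex^'n^'n"
  assumes "nil_len M l y \<le> nil_len M l w" "separated (cyc M l y) \<subset> separated (cyc M l w)"
  shows "cyc_weight M (l, y) < cyc_weight M (l, w)"
  unfolding cyc_weight_def
  using psubset_card_mono[OF finite assms(2)] mult_right_mono[OF assms(1), of "CARD('n \<times> 'n) + 1"]
  by simp

lemma invariant_subspace_cyc_span: "invariant_subspace M (cyc_span M G)"
  unfolding cyc_span_def
  by (rule invariant_subspace_span_Union) (auto intro: invariant_subspace_cyc)

lemma cyc_subset_cyc_span: "g \<in> G \<Longrightarrow> cyc M (fst g) (snd g) \<subseteq> cyc_span M G"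
  unfolding cyc_span_def by (auto intro: vec.span_base)

lemma cyc_span_mono: "G \<subseteq> H \<Longrightarrow> cyc_span M G \<subseteq> cyc_span M H"
  unfolding cyc_span_def by (intro vec.span_mono) auto

lemma subspace_cyc_span: "vec.subspace (cyc_span M G)"
  by (simp add: cyc_span_def)

text \<open>A basis is selected from the generalized eigenvectors, and each basis vector is the top
  of its own chain.\<close>

lemma spanning_family_exists:
  fixes M :: "complex^'n^'n"
  shows "\<exists>G. spanning_family M G"
proof -
  obtain B where B: "B \<subseteq> (\<Union>l. gen_eigenspace M l)" "vec.independent B"
    "(\<Union>l. gen_eigenspace M l) \<subseteq> vec.span B"
    using vec.maximal_independent_subset by metis
  then obtain f where f: "\<And>w. w \<in> B \<Longrightarrow> w \<in> gen_eigenspace M (f w)"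
    by (metis UN_E subsetD)
  let ?G = "(\<lambda>w. (f w, w)) ` B"
  have "vec.span B = UNIV"
    using vec.span_mono[OF B(3)] span_gen_eigenspaces[of M] by (simp add: top_unique vec.span_span)
  moreover have "vec.span B \<subseteq> cyc_span M ?G"
    unfolding cyc_span_def by (intro vec.span_mono) (auto intro: cyc_self)
  moreover have "0 \<notin> B" using B(2) vec.dependent_zero by blast
  ultimately have "spanning_family M ?G"
    unfolding spanning_family_def using f vec.finiteI_independent[OF B(2)] by auto
  then show ?thesis ..
qed

lemma minimal_family_exists: "\<exists>G. minimal_family M G"
proof -
  obtain G0 where "spanning_family M G0" using spanning_family_exists by blast
  then obtain G where "spanning_family M G"
    "\<And>G'. spanning_family M G' \<Longrightarrow> sum (cyc_weight M) G \<le> sum (cyc_weight M) G'"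
    using ex_has_least_nat[of "spanning_family M" G0 "sum (cyc_weight M)"] by blast
  then show ?thesis unfolding minimal_family_def by blast
qed

text \<open>Descending induction along the chain: once the next iterate of \<open>w\<close> is in
  \<open>V\<close>, so is the \<open>i\<close>-th iterate of \<open>r\<close>, and the equation for
  \<open>y\<close> puts the \<open>i\<close>-th iterate of \<open>w\<close> into
  \<open>V\<close>.\<close>

lemma cyc_exchange:
  assumes V: "invariant_subspace M V" "y \<in> V" "s \<in> V"
    and w: "w \<in> gen_eigenspace M l"
    and y: "y = a *s w + r + s" "a \<noteq> 0" "r \<in> cyc M l (shifted M l w)"
  shows "w \<in> V"
proof -
  have sub: "vec.subspace V" using V(1) by (simp add: invariant_subspace_def)
  \<comment> \<open>\<open>j\<close> bounds the number of iterates left before the chain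
    vanishes.\<close>
  have "nil_len M l w \<le> i + j \<Longrightarrow> (shifted M l ^^ i) w \<in> V" for i j
  proof (induction j arbitrary: i)
    case 0
    then have "(shifted M l ^^ i) w = 0" using nil_len_le_iff[OF w] by simp
    then show ?case by (simp add: vec.subspace_0[OF sub])
  next
    case (Suc j)
    then have "(shifted M l ^^ i) (shifted M l w) \<in> V"
      using Suc.IH[of "Suc i"] by (simp add: shifted_pow_commute)
    then have "(shifted M l ^^ i) r \<in> V"
      using shifted_pow_cyc[OF y(3), of i] cyc_minimal[OF V(1)] by blast
    moreover have "(shifted M l ^^ i) y \<in> V" "(shifted M l ^^ i) s \<in> V"
      using V by (auto intro: invariant_subspace_shifted_pow)
    moreover have "a *s (shifted M l ^^ i) w
        = (shifted M l ^^ i) y - (shifted M l ^^ i) r - (shifted M l ^^ i) s"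
      by (simp add: y(1) shifted_pow_simps)
    ultimately have "a *s (shifted M l ^^ i) w \<in> V"
      using sub by (simp add: vec.subspace_diff)
    then have "(1 / a) *s (a *s (shifted M l ^^ i) w) \<in> V"
      using sub vec.subspace_scale by blast
    then show ?case using y(2) by simp
  qed
  from this[of 0 "nil_len M l w"] show ?thesis by simp
qed

text \<open>By \<open>cyc_exchange\<close>, putting \<open>y\<close> in place of \<open>w\<close>
  keeps the family spanning, so \<open>y\<close> cannot be lighter.\<close>

lemma minimal_family_exchange:
  assumes G: "minimal_family M G" "(l, w) \<in> G"
    and y: "y = a *s w + r + s" "a \<noteq> 0" "r \<in> cyc M l (shifted M l w)"
      "s \<in> cyc_span M (G - {(l, w)})"
    and y': "y \<in> gen_eigenspace M l"
  shows "cyc_weight M (l, w) \<le> cyc_weight M (l, y)"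
proof -
  have fin: "finite G" and span: "cyc_span M G = UNIV"
    and gen: "\<And>g. g \<in> G \<Longrightarrow> snd g \<noteq> 0 \<and> snd g \<in> gen_eigenspace M (fst g)"
    using G(1) by (auto simp: minimal_family_def spanning_family_def)
  \<comment> \<open>Generators are nonzero, so for \<open>y = 0\<close> the pair is simply
    dropped.\<close>
  define G' where "G' = (G - {(l, w)}) \<union> (if y = 0 then {} else {(l, y)})"
  let ?V = "cyc_span M G'"
  have V: "invariant_subspace M ?V" by (rule invariant_subspace_cyc_span)
  have "y \<in> ?V"
  proof (cases "y = 0")
    case True
    then show ?thesis by (simp add: vec.subspace_0 subspace_cyc_span)
  next
    case False
    then have "(l, y) \<in> G'" by (simp add: G'_def)
    from cyc_subset_cyc_span[OF this] show ?thesis using cyc_self[of y M l] by auto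
  qed
  moreover have "s \<in> ?V" using y(4) cyc_span_mono[of "G - {(l, w)}" G' M] unfolding G'_def by blast
  ultimately have "w \<in> ?V"
    using cyc_exchange[OF V _ _ _ y(1-3)] gen[OF G(2)] by simp
  then have "cyc M (fst g) (snd g) \<subseteq> ?V" if "g \<in> G" for g
    using that cyc_minimal[OF V] cyc_subset_cyc_span[of g G'] by (cases "g = (l, w)") (auto simp: G'_def)
  then have "cyc_span M G \<subseteq> ?V"
    unfolding cyc_span_def[of M G] by (intro vec.span_minimal subspace_cyc_span) auto
  then have "spanning_family M G'"
    unfolding spanning_family_def using span fin gen y' by (auto simp: G'_def)
  then have "sum (cyc_weight M) G \<le> sum (cyc_weight M) G'"
    using G(1) by (simp add: minimal_family_def)
  also have "\<dots> \<le> sum (cyc_weight M) (insert (l, y) (G - {(l, w)}))"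
    using fin by (intro sum_mono2) (auto simp: G'_def)
  \<comment> \<open>Only an inequality, since \<open>(l, y)\<close> may already belong to the
    remaining family.\<close>
  also have "\<dots> \<le> cyc_weight M (l, y) + sum (cyc_weight M) (G - {(l, w)})"
    using fin by (simp add: sum.insert_if)
  also have "sum (cyc_weight M) G = cyc_weight M (l, w) + sum (cyc_weight M) (G - {(l, w)})"
    using fin G(2) by (simp add: sum.remove)
  finally show ?thesis by simp
qed

section \<open>A family of minimal weight is direct\<close>

lemma span_UN_decompose:
  assumes "finite G" "\<And>g. g \<in> G \<Longrightarrow> vec.subspace (B g)" "x \<in> vec.span (\<Union>g\<in>G. B g)"
  shows "\<exists>f. (\<forall>g\<in>G. f g \<in> B g) \<and> x = (\<Sum>g\<in>G. f g)"
  using assms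
proof (induction G arbitrary: x rule: finite_induct)
  case (insert h G)
  then obtain p q where "x = p + q" "p \<in> vec.span (B h)" "q \<in> vec.span (\<Union>g\<in>G. B g)"
    by (auto simp: vec.span_Un)
  moreover from this obtain f where "\<forall>g\<in>G. f g \<in> B g" "q = (\<Sum>g\<in>G. f g)"
    using insert by blast
  moreover have "vec.span (B h) = B h" using insert.prems(1)[of h] by (simp add: vec.span_eq_iff)
  moreover have "(\<Sum>g\<in>G. (f(h := p)) g) = (\<Sum>g\<in>G. f g)"
    using insert.hyps(2) by (intro sum.cong) auto
  ultimately show ?case
    using insert.hyps by (intro exI[of _ "f(h := p)"]) auto
qed simp

lemma nil_len_shifted_le:
  "x \<in> gen_eigenspace M l \<Longrightarrow> nil_len M l (shifted M m x) \<le> nil_len M l x"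
  by (rule nil_len_le) (simp add: shifted_pow_commute nil_len_zero)

text \<open>In a relation of minimal total length all summands are eigenvectors for the same eigenvalue,
  since applying \<open>shifted M l\<close> would otherwise give a shorter one. Factoring out the largest possible power
  of \<open>shifted M l\<close> then produces a generator that can replace a longer one.\<close>

lemma minimal_family_independent:
  assumes G: "minimal_family M G"
    and f: "\<And>g. g \<in> G \<Longrightarrow> f g \<in> cyc M (fst g) (snd g)" "(\<Sum>g\<in>G. f g) = 0"
    and g: "g \<in> G"
  shows "f g = 0"
proof (rule ccontr)
  assume "f g \<noteq> 0"
  have fin: "finite G" and gen: "\<And>g. g \<in> G \<Longrightarrow> snd g \<in> gen_eigenspace M (fst g)"
    using G by (auto simp: minimal_family_def spanning_family_def)
  define P where "P f \<longleftrightarrow> (\<forall>g\<in>G. f g \<in> cyc M (fst g) (snd g)) \<and> (\<Sum>g\<in>G. f g) = 0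
    \<and> (\<exists>g\<in>G. f g \<noteq> 0)" for f
  define \<mu> where "\<mu> f = (\<Sum>g\<in>G. nil_len M (fst g) (f g))" for f
  have "P f" unfolding P_def using f g \<open>f g \<noteq> 0\<close> by blast
  then obtain f where Pf: "P f" and min: "\<And>f'. P f' \<Longrightarrow> \<mu> f \<le> \<mu> f'"
    using ex_has_least_nat[of P f \<mu>] by blast
  then have mem: "f g \<in> gen_eigenspace M (fst g)" if "g \<in> G" for g
    using that cyc_subset_gen_eigenspace[OF gen[OF that]] by (auto simp: P_def)
  have kill: "shifted M (fst j) (f i) = 0" if "j \<in> G" "f j \<noteq> 0" "i \<in> G" for i j
  proof (rule ccontr)
    assume nz: "shifted M (fst j) (f i) \<noteq> 0"
    let ?f = "\<lambda>g. shifted M (fst j) (f g)"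
    have "(\<Sum>g\<in>G. ?f g) = shifted M (fst j) (\<Sum>g\<in>G. f g)"
      by (rule vec.linear_sum[OF linear_shifted, symmetric])
    then have "P ?f"
      unfolding P_def using Pf nz that
      by (auto simp: P_def intro: invariant_subspace_shifted[OF invariant_subspace_cyc])
    then have "\<mu> f \<le> \<mu> ?f" by (rule min)
    moreover have "nil_len M (fst j) (?f j) < nil_len M (fst j) (f j)"
      using nil_len_shifted[OF mem[OF that(1)]] nil_len_pos[OF mem[OF that(1)] that(2)] by simp
    \<comment> \<open>No other summand gets longer, because the shifted operators commute.\<close>
    then have "\<mu> ?f < \<mu> f"
      unfolding \<mu>_def using fin that(1) nil_len_shifted_le[OF mem] by (intro sum_strict_mono_ex1) auto
    ultimately show False by simp
  qed
  define K where "K = (\<lambda>g. nil_len M (fst g) (snd g))"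
  define S where "S = {g\<in>G. f g \<noteq> 0}"
  have finS: "finite S" using fin by (simp add: S_def)
  \<comment> \<open>The shortest chain involved is the one to be replaced, so the exponents
    \<open>K g - K g0\<close> below are genuine differences.\<close>
  obtain g0 where g0: "g0 \<in> S" and K0: "\<And>g. g \<in> S \<Longrightarrow> K g0 \<le> K g"
    using Pf ex_has_least_nat[of "\<lambda>g. g \<in> S" _ K] unfolding P_def S_def by blast
  define l where "l = fst g0"
  have same: "fst g = l" if "g \<in> S" for g
  proof -
    have "shifted M (fst g) (f g) = 0" "shifted M l (f g) = 0"
      using kill that g0 by (auto simp: S_def l_def)
    then have "(fst g - l) *s f g = 0"
      by (simp add: shifted_def vec.scale_left_diff_distrib)
    then show ?thesis using that by (simp add: S_def)
  qed
  have "\<exists>c. f g = c *s (shifted M l ^^ (K g - 1)) (snd g)" if "g \<in> S" for g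
    using cyc_socle[OF gen, of g "f g"] kill[of g g] same[OF that] that Pf
    by (auto simp: S_def P_def K_def)
  then obtain c where c: "\<And>g. g \<in> S \<Longrightarrow> f g = c g *s (shifted M l ^^ (K g - 1)) (snd g)"
    by metis
  \<comment> \<open>The relation with the power \<open>K g0 - 1\<close> factored out; that power
    kills \<open>t\<close>, so \<open>t\<close> is shorter than the generator of
    \<open>g0\<close>.\<close>
  define t where "t = (\<Sum>g\<in>S. c g *s (shifted M l ^^ (K g - K g0)) (snd g))"
  define s where "s = (\<Sum>g\<in>S - {g0}. c g *s (shifted M l ^^ (K g - K g0)) (snd g))"
  have gG: "g0 \<in> G" "(l, snd g0) \<in> G" "snd g0 \<noteq> 0"
    using g0 G by (auto simp: S_def l_def minimal_family_def spanning_family_def)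
  have Kpos: "0 < K g0"
    using nil_len_pos[OF gen[OF gG(1)] gG(3)] by (simp add: K_def)
  have "(shifted M l ^^ (K g0 - 1)) t = (\<Sum>g\<in>S. f g)"
    unfolding t_def vec.linear_sum[OF linear_shifted_pow]
  proof (intro sum.cong refl)
    fix g assume g: "g \<in> S"
    have "(shifted M l ^^ (K g0 - 1)) ((shifted M l ^^ (K g - K g0)) (snd g))
        = (shifted M l ^^ (K g - 1)) (snd g)"
      using K0[OF g] Kpos by (simp flip: funpow_add[THEN fun_cong, unfolded comp_def])
    then show "(shifted M l ^^ (K g0 - 1)) (c g *s (shifted M l ^^ (K g - K g0)) (snd g)) = f g"
      using c[OF g] by (simp add: shifted_pow_simps)
  qed
  also have "\<dots> = (\<Sum>g\<in>G. f g)"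
    using fin by (intro sum.mono_neutral_left) (auto simp: S_def)
  finally have t0: "(shifted M l ^^ (K g0 - 1)) t = 0"
    using Pf by (simp add: P_def)
  then have tgen: "t \<in> gen_eigenspace M l" by (auto simp: gen_eigenspace_def)
  have "nil_len M l t < nil_len M l (snd g0)"
    using nil_len_le[OF t0] Kpos by (simp add: K_def l_def)
  then have "cyc_weight M (l, t) < cyc_weight M (l, snd g0)" by (rule cyc_weight_less_len)
  moreover have "t = c g0 *s snd g0 + 0 + s"
    unfolding t_def s_def by (subst sum.remove[OF finS g0]) simp
  moreover have "c g0 \<noteq> 0" using c[OF g0] g0 by (auto simp: S_def)
  moreover have "s \<in> cyc_span M (G - {(l, snd g0)})"
    unfolding s_def
  proof (intro vec.subspace_sum subspace_cyc_span vec.subspace_scale)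
    fix g assume g: "g \<in> S - {g0}"
    then have "g \<in> G - {(l, snd g0)}" by (auto simp: S_def l_def)
    from cyc_subset_cyc_span[OF this]
    show "(shifted M l ^^ (K g - K g0)) (snd g) \<in> cyc_span M (G - {(l, snd g0)})"
      using cyc_pow_mem same g by (metis DiffD1 subsetD)
  qed
  ultimately show False
    using minimal_family_exchange[OF G gG(2), of t "c g0" 0 s] tgen vec.subspace_0[OF subspace_cyc]
    by (metis not_le)
qed

text \<open>Existence is spanning; for uniqueness, two decompositions differ by a relation whose
  terms all vanish.\<close>

lemma direct_sum_whole_minimal_family:
  fixes M :: "complex^'n^'n"
  assumes G: "minimal_family M (set gs)" and dist: "distinct gs"
  shows "direct_sum_whole (map (\<lambda>g. cyc M (fst g) (snd g)) gs)"
  unfolding direct_sum_whole_def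
proof (intro allI ex_ex1I)
  fix x :: "complex^'n"
  let ?J = "\<lambda>g. cyc M (fst g) (snd g)"
  have "x \<in> vec.span (\<Union>g\<in>set gs. ?J g)"
    using G by (simp add: minimal_family_def spanning_family_def cyc_span_def)
  then obtain f where f: "\<forall>g\<in>set gs. f g \<in> ?J g" "x = (\<Sum>g\<in>set gs. f g)"
    using span_UN_decompose[of "set gs" ?J x] by auto
  then show "\<exists>ys. length ys = length (map ?J gs) \<and>
      (\<forall>i<length (map ?J gs). ys ! i \<in> map ?J gs ! i) \<and> x = sum_list ys"
    using dist by (intro exI[of _ "map f gs"]) (auto simp: sum_list_distinct_conv_sum_set)
next
  fix x :: "complex^'n" and ys zs
  let ?J = "\<lambda>g. cyc M (fst g) (snd g)"
  assume "length ys = length (map ?J gs) \<and>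
      (\<forall>i<length (map ?J gs). ys ! i \<in> map ?J gs ! i) \<and> x = sum_list ys"
    and "length zs = length (map ?J gs) \<and>
      (\<forall>i<length (map ?J gs). zs ! i \<in> map ?J gs ! i) \<and> x = sum_list zs"
  then have ys: "length ys = length gs" "\<And>i. i < length gs \<Longrightarrow> ys ! i \<in> ?J (gs ! i)" "x = sum_list ys"
    and zs: "length zs = length gs" "\<And>i. i < length gs \<Longrightarrow> zs ! i \<in> ?J (gs ! i)" "x = sum_list zs"
    by auto
  have bij: "bij_betw (\<lambda>i. gs ! i) {..<length gs} (set gs)"
    by (rule bij_betw_nth[OF dist]) auto
  \<comment> \<open>Distinctness of \<open>gs\<close> lets each generator recover its position,
    turning the lists into a function on generators.\<close>
  define f where "f g = (let i = the_inv_into {..<length gs} (\<lambda>i. gs ! i) g in ys ! i - zs ! i)" for g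
  have f: "f (gs ! i) = ys ! i - zs ! i" if "i < length gs" for i
    using that bij by (simp add: f_def the_inv_into_f_f bij_betw_def)
  have "(\<Sum>g\<in>set gs. f g) = (\<Sum>i<length gs. f (gs ! i))"
    by (rule sum.reindex_bij_betw[OF bij, symmetric])
  also have "\<dots> = (\<Sum>i<length gs. ys ! i) - (\<Sum>i<length gs. zs ! i)"
    by (simp add: f sum_subtractf)
  also have "\<dots> = 0"
    using ys zs by (simp add: sum_list_sum_nth atLeast0LessThan)
  finally have sum0: "(\<Sum>g\<in>set gs. f g) = 0" .
  have mem: "f g \<in> ?J g" if "g \<in> set gs" for g
    using that f ys(2) zs(2) by (metis in_set_conv_nth subspace_cyc vec.subspace_diff)
  show "ys = zs"
  proof (rule nth_equalityI)
    fix i assume "i < length ys"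
    then have "i < length gs" using ys(1) by simp
    with minimal_family_independent[OF G mem sum0, of "gs ! i"] f show "ys ! i = zs ! i" by simp
  qed (simp add: ys zs)
qed

section \<open>A family of minimal weight is special\<close>

text \<open>A triangular system: the coefficient of the \<open>m\<close>-th iterate of
  \<open>u\<close> corrects the iterate of \<open>w + z\<close> with exponent \<open>n - m\<close>
  through the bottom vector of \<open>u\<close>, and leaves all higher iterates unchanged.\<close>

lemma cyc_equalize:
  assumes "(shifted M l ^^ k) w = 0" "(shifted M l ^^ k) u = 0" "k = Suc n"
    and "((shifted M l ^^ n) u) $ a \<noteq> ((shifted M l ^^ n) u) $ b"
  shows "\<exists>z\<in>cyc M l u. (a, b) \<notin> separated (cyc M l (w + z))"
proof -
  let ?N = "shifted M l"
  have "m \<le> k \<Longrightarrow> \<exists>z\<in>cyc M l u. \<forall>i\<ge>k - m. ((?N ^^ i) (w + z)) $ a = ((?N ^^ i) (w + z)) $ b" for m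
  proof (induction m)
    case 0
    show ?case
      using shifted_pow_zero_mono[OF assms(1)] vec.subspace_0[OF subspace_cyc]
      by (intro bexI[of _ 0]) auto
  next
    case (Suc m)
    then obtain z where z: "z \<in> cyc M l u"
      "\<And>i. i \<ge> k - m \<Longrightarrow> ((?N ^^ i) (w + z)) $ a = ((?N ^^ i) (w + z)) $ b"
      by auto
    define i0 where "i0 = k - Suc m"
    define e where "e x = x $ a - x $ b" for x :: "complex^'a"
    \<comment> \<open>Solves the single equation at exponent \<open>i0\<close>; the denominator is
      nonzero because the bottom vector of \<open>u\<close> separates \<open>a\<close> and
      \<open>b\<close>.\<close>
    define c where "c = - e ((?N ^^ i0) (w + z)) / e ((?N ^^ n) u)"
    define z' where "z' = z + c *s (?N ^^ m) u"
    have i: "(?N ^^ i) (w + z') = (?N ^^ i) (w + z) + c *s (?N ^^ (i + m)) u" for i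
      by (simp add: z'_def shifted_pow_simps funpow_add)
    have "e ((?N ^^ i) (w + z')) = 0" if "i \<ge> k - Suc m" for i
    proof (cases "i = i0")
      case True
      have "i0 + m = n" using Suc.prems assms(3) by (simp add: i0_def)
      then show ?thesis
        using assms(4) by (simp add: i True e_def c_def field_simps)
    next
      case False
      then have "i \<ge> k - m" "k \<le> i + m" using that by (auto simp: i0_def)
      then show ?thesis
        using z(2)[of i] shifted_pow_zero_mono[OF assms(2)] by (simp add: i e_def)
    qed
    moreover have "z' \<in> cyc M l u"
      unfolding z'_def using z(1)
      by (intro vec.subspace_add vec.subspace_scale subspace_cyc cyc_pow_mem)
    ultimately show ?case by (intro bexI[of _ z']) (simp_all add: e_def)
  qed
  from this[of k] show ?thesis by (auto simp: separated_cyc)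
qed

text \<open>\<open>sync\<close> says that no Jordan chain of length at least 2 starts with a
  constant vector; this is how regularity of the network enters.\<close>

lemma minimal_family_special:
  fixes M :: "complex^'n^'n"
  assumes G: "minimal_family M G" "(l, w) \<in> G"
    and sync: "\<And>z. shifted M l z \<in> full_sync \<Longrightarrow> shifted M l (shifted M l z) = 0 \<Longrightarrow> shifted M l z = 0"
  shows "special_jordan_subspace M l (cyc M l w)"
  unfolding special_jordan_subspace_def
proof (intro conjI allI impI)
  have span: "cyc_span M G = UNIV"
    and w: "w \<noteq> 0" "w \<in> gen_eigenspace M l"
    using G by (auto simp: minimal_family_def spanning_family_def)
  then show "jordan_subspace M l (cyc M l w)"
    unfolding jordan_subspace_iff_cyc by blast
  let ?N = "shifted M l"
  fix U
  assume "jordan_subspace M l U \<and> vec.dim U = vec.dim (cyc M l w)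
      \<and> poly_hull U \<subseteq> poly_hull (cyc M l w)"
  then obtain u where u: "u \<noteq> 0" "u \<in> gen_eigenspace M l" and U: "U = cyc M l u"
    and dim: "vec.dim U = vec.dim (cyc M l w)"
    and hull: "poly_hull U \<subseteq> poly_hull (cyc M l w)"
    unfolding jordan_subspace_iff_cyc by blast
  have len: "nil_len M l u = nil_len M l w" using dim dim_cyc u(2) w(2) U by metis
  have sep: "separated U \<subseteq> separated (cyc M l w)" by (rule separated_mono_poly_hull[OF hull])
  show "poly_hull U = poly_hull (cyc M l w) \<or> U = full_sync"
  proof (rule disjCI, rule ccontr)
    assume nF: "U \<noteq> full_sync" and neq: "poly_hull U \<noteq> poly_hull (cyc M l w)"
    let ?S = "cyc_span M (G - {(l, w)})"
    have "(\<Union>g\<in>G. cyc M (fst g) (snd g)) = cyc M l w \<union> (\<Union>g\<in>G - {(l, w)}. cyc M (fst g) (snd g))"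
      using G(2) by force
    then have "u \<in> vec.span (cyc M l w \<union> (\<Union>g\<in>G - {(l, w)}. cyc M (fst g) (snd g)))"
      using span by (simp add: cyc_span_def)
    then obtain p s where u_ps: "u = p + s" "p \<in> vec.span (cyc M l w)" "s \<in> ?S"
      by (auto simp: vec.span_Un cyc_span_def)
    then have "p \<in> cyc M l w" by (simp add: vec.span_eq_iff[THEN iffD2])
    then obtain a r where ar: "p = a *s w + r" "r \<in> cyc M l (?N w)" by (rule cyc_decompose)
    show False
    proof (cases "a = 0")
      \<comment> \<open>\<open>u\<close> itself can replace \<open>w\<close>: same length, fewer
        separated pairs.\<close>
      case False
      then have "cyc_weight M (l, w) \<le> cyc_weight M (l, u)"
        using u_ps(1) ar(1) by (intro minimal_family_exchange[OF G _ _ ar(2) u_ps(3) u(2)]) simp_all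
      moreover have "separated U \<noteq> separated (cyc M l w)" using neq by (auto simp: poly_hull_eq)
      then have "cyc_weight M (l, u) < cyc_weight M (l, w)"
        using sep len U by (intro cyc_weight_less_separated) auto
      ultimately show False by simp
    next
      case True
      define n where "n = nil_len M l w - 1"
      have k: "nil_len M l w = Suc n" using nil_len_pos[OF w(2,1)] by (simp add: n_def)
      have u0: "(?N ^^ Suc n) u = 0" and w0: "(?N ^^ Suc n) w = 0"
        using nil_len_zero[OF u(2)] nil_len_zero[OF w(2)] len k by auto
      have u1: "(?N ^^ n) u \<noteq> 0" using nil_len_le[of n M l u] len k by auto
      \<comment> \<open>By \<open>sync\<close>, a constant bottom vector forces
        \<open>n = 0\<close>, and then \<open>U\<close> is the line of constant vectors.\<close>
      have "(?N ^^ n) u \<notin> full_sync"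
      proof
        assume F: "(?N ^^ n) u \<in> full_sync"
        have "n = 0"
        proof (rule ccontr)
          assume "n \<noteq> 0"
          then obtain m where "n = Suc m" by (cases n) auto
          then show False using sync[of "(?N ^^ m) u"] F u0 u1 by simp
        qed
        then have "U = vec.span {u}" and F: "u \<in> full_sync"
          using cyc_eq_span_image[OF u0] F by (simp_all add: U lessThan_Suc)
        moreover have "full_sync = vec.span {u}"
        proof
          show "vec.span {u} \<subseteq> full_sync"
            using F by (auto simp: vec.span_singleton full_sync_def)
          show "full_sync \<subseteq> vec.span {u}"
          proof
            fix x :: "complex^'n" assume x: "x \<in> full_sync"
            obtain i where i: "u $ i \<noteq> 0" using u(1) by (auto simp: vec_eq_iff)
            have const: "x $ j = x $ i" "u $ j = u $ i" for j
              using x F unfolding full_sync_def by blast+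
            have "x $ j = ((x $ i / u $ i) *s u) $ j" for j
              unfolding vector_smult_component const[of j] using i by simp
            then have "x = (x $ i / u $ i) *s u"
              unfolding vec_eq_iff by blast
            then show "x \<in> vec.span {u}" unfolding vec.span_singleton by blast
          qed
        qed
        ultimately show False using nF by simp
      qed
      then obtain i j where ij: "((?N ^^ n) u) $ i \<noteq> ((?N ^^ n) u) $ j"
        unfolding full_sync_def by blast
      obtain z where z: "z \<in> cyc M l u" "(i, j) \<notin> separated (cyc M l (w + z))"
        using cyc_equalize[OF w0 u0 refl ij] by blast
      let ?y = "w + z"
      \<comment> \<open>An invariant subspace containing \<open>u\<close>, since
        \<open>a = 0\<close>. It therefore contains \<open>z\<close>, so \<open>w + z\<close> has
        coefficient 1 at \<open>w\<close> and may replace it.\<close>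
      let ?R = "vec.span (cyc M l (?N w) \<union> ?S)"
      have R: "invariant_subspace M ?R"
        by (rule invariant_subspace_span_Union[of "{cyc M l (?N w), ?S}" M, simplified])
          (auto intro: invariant_subspace_cyc invariant_subspace_cyc_span)
      have "u = r + s" using u_ps(1) ar(1) True by simp
      then have "u \<in> ?R" using ar(2) u_ps(3) by (simp add: vec.span_add vec.span_base)
      then have "z \<in> ?R" using cyc_minimal[OF R] z(1) by blast
      then obtain r' s' where rs: "z = r' + s'" "r' \<in> vec.span (cyc M l (?N w))" "s' \<in> vec.span ?S"
        by (auto simp: vec.span_Un)
      then have rs': "r' \<in> cyc M l (?N w)" "s' \<in> ?S"
        by (simp_all add: vec.span_eq_iff[THEN iffD2] subspace_cyc_span)
      have "(?N ^^ Suc n) z = 0" by (rule cyc_pow_zero[OF u0 z(1)])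
      then have y0: "(?N ^^ Suc n) ?y = 0"
        unfolding vec.linear_add[OF linear_shifted_pow] using w0 by (simp only: add_0)
      then have "?y \<in> gen_eigenspace M l" unfolding gen_eigenspace_def by blast
      then have "cyc_weight M (l, w) \<le> cyc_weight M (l, ?y)"
        using minimal_family_exchange[OF G _ _ rs', of ?y 1] rs(1) by (simp add: add.assoc)
      \<comment> \<open>A pair not separated by the chain of \<open>w\<close> is not separated by
        \<open>U\<close> either, hence not by the new chain.\<close>
      moreover have "separated (cyc M l ?y) \<subseteq> separated (cyc M l w)"
      proof (clarify, rule ccontr)
        fix p q assume pq: "(p, q) \<in> separated (cyc M l ?y)" and npq: "(p, q) \<notin> separated (cyc M l w)"
        have "(?N ^^ m) z \<in> cyc M l u" for m
          by (rule invariant_subspace_shifted_pow[OF invariant_subspace_cyc z(1)])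
        then have "((?N ^^ m) z) $ p = ((?N ^^ m) z) $ q" for m
          using npq sep unfolding U separated_def by blast
        moreover have "((?N ^^ m) w) $ p = ((?N ^^ m) w) $ q" for m
          using npq by (auto simp: separated_cyc)
        ultimately show False using pq by (simp add: separated_cyc shifted_pow_simps)
      qed
      \<comment> \<open>The pair equalized by \<open>z\<close> was separated before, so the
        inclusion is strict.\<close>
      moreover have "(i, j) \<in> separated (cyc M l w)"
        using ij sep unfolding U by (meson separated_cyc subsetD)
      then have "separated (cyc M l ?y) \<noteq> separated (cyc M l w)" using z(2) by blast
      ultimately show False
        using cyc_weight_less_separated[of M l ?y w] nil_len_le[OF y0] k by (simp add: psubset_eq)
    qed
  qed
qed

text \<open>Were this to fail, \<open>l\<close> would be the valency; but a solution of
  \<open>A z = v z + c\<close> with constant \<open>c \<noteq> 0\<close> (scale \<open>c\<close> to 1 and take real parts) violates the maximum principle at a maximal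
  entry of \<open>z\<close>.\<close>

lemma regular_network_full_sync_semisimple:
  fixes A :: "nat^'n^'n"
  assumes A: "regular_network A v"
    and F: "shifted (cmat A) l z \<in> full_sync" and ker: "shifted (cmat A) l (shifted (cmat A) l z) = 0"
  shows "shifted (cmat A) l z = 0"
proof (rule ccontr)
  let ?y = "shifted (cmat A) l z"
  assume nz: "?y \<noteq> 0"
  obtain d where d: "\<And>i. ?y $ i = d" using F unfolding full_sync_def by blast
  then have d0: "d \<noteq> 0" using nz by (auto simp: vec_eq_iff)
  have row: "(\<Sum>j\<in>UNIV. of_nat (A $ i $ j)) = (of_nat v :: complex)"
    "(\<Sum>j\<in>UNIV. of_nat (A $ i $ j)) = (of_nat v :: real)" for i
    using A unfolding regular_network_def by (metis of_nat_sum)+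
  have mult: "(cmat A *v x) $ i = (\<Sum>j\<in>UNIV. of_nat (A $ i $ j) * x $ j)" for x i
    by (simp add: matrix_vector_mult_def cmat_def)
  \<comment> \<open>Any cell will do: its row sum shows that the constant eigenvector
    \<open>?y\<close> has eigenvalue \<open>v\<close>.\<close>
  fix i0 :: 'n
  have "(cmat A *v ?y) $ i0 = of_nat v * d"
    by (simp add: mult d row flip: sum_distrib_right)
  moreover have "cmat A *v ?y = l *s ?y" using ker by (simp add: shifted_def)
  ultimately have lv: "l = of_nat v" using d[of i0] d0 by simp
  define r where "r j = Re (z $ j / d)" for j
  have eq: "(\<Sum>j\<in>UNIV. of_nat (A $ i $ j) * r j) = of_nat v * r i + 1" for i
  proof -
    have "(\<Sum>j\<in>UNIV. of_nat (A $ i $ j) * z $ j) = of_nat v * z $ i + d"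
      using d[of i] lv by (simp add: shifted_def mult algebra_simps)
    then have "(\<Sum>j\<in>UNIV. of_nat (A $ i $ j) * z $ j) / d = of_nat v * (z $ i / d) + 1"
      using d0 by (simp add: field_simps)
    then have "(\<Sum>j\<in>UNIV. of_nat (A $ i $ j) * (z $ j / d)) = of_nat v * (z $ i / d) + 1"
      by (simp add: sum_divide_distrib)
    from arg_cong[OF this, of Re] show ?thesis
      unfolding r_def Re_sum by (simp del: times_divide_eq_right)
  qed
  have "Max (range r) \<in> range r" by (intro Max_in) simp_all
  then obtain i where "Max (range r) = r i" by blast
  then have i: "r j \<le> r i" for j using Max_ge[of "range r" "r j"] by simp
  have "(\<Sum>j\<in>UNIV. of_nat (A $ i $ j) * r j) \<le> (\<Sum>j\<in>UNIV. of_nat (A $ i $ j) * r i)"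
    by (intro sum_mono mult_left_mono i) simp
  also have "\<dots> = of_nat v * r i" by (simp add: row flip: sum_distrib_right)
  finally show False using eq[of i] by simp
qed

theorem mainTheorem6:
  fixes A :: "nat^'n^'n" and v :: nat
  assumes "regular_network A v"
  shows "\<exists>Js :: (complex^'n) set list. direct_sum_whole Js \<and>
           (\<forall>J\<in>set Js. \<exists>l. special_jordan_subspace (cmat A) l J)"
proof -
  obtain G where G: "minimal_family (cmat A) G" using minimal_family_exists by blast
  then have "finite G" unfolding minimal_family_def spanning_family_def by simp
  then obtain gs where gs: "set gs = G" "distinct gs" using finite_distinct_list by blast
  have "special_jordan_subspace (cmat A) (fst g) (cyc (cmat A) (fst g) (snd g))" if "g \<in> G" for g
    by (rule minimal_family_special[OF G]) (use that regular_network_full_sync_semisimple[OF assms] in auto)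
  moreover have "direct_sum_whole (map (\<lambda>g. cyc (cmat A) (fst g) (snd g)) gs)"
    using G gs by (intro direct_sum_whole_minimal_family) simp_all
  ultimately show ?thesis
    using gs(1) by (intro exI[of _ "map (\<lambda>g. cyc (cmat A) (fst g) (snd g)) gs"]) auto
qed

end
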